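(* Let $(X,d)$ be a separable metric space and let $M\subset X$ be a closed subspace such that $M$ is also a Banach space with the induced metric (i.e. the norm of $M$ satisfies $\|a-b\|=d(a,b)$ for $a,b\in M$). Then there is a continuous function $g:X\to M$ such that $g$ is the identity on $M$ and such that $g$ is internally computable in an enumeration $\{a_n\}_{n\in\mathbb{N}}$ of a dense subset of $M$, the metric $d$ on $X$, and the distance function $x\mapsto d(x,M)$.
   Context: All Banach spaces are real; $\mathbb{N}$ starts with $0$; $d(x,M)=\inf_{a\in M}d(x,a)$. **Operators.** (Case) For partial functions $f,g$ from $\mathbb{R}$ to a set and $y\in\mathbb{R}$, $Case(f,g,y)(x)$ is $f(x)$ if $x<y$, $g(x)$ if $y<x$, $z$ if $x=y$ and $f(y)=g(y)=z$, and undefined if $x=y$ and $f(y)\ne g(y)$. (Modified limit) For a sequence $\{w_k\}_{k\in\mathbb{N}}$ in a Banach space let $w^m_0=w_0$ and $w^m_{k+1}=w^m_k+\lambda_k(w_{k+1}-w^m_k)$, where $\lambda_k=1$ if $\|w_{k+1}-w^m_k\|\le 2^{-k}$ and $\lambda_k=2^{-k}/\|w_{k+1}-w^m_k\|$ if $\|w_{k+1}-w^m_k\|\ge 2^{-k}$. The modified limit is $ml(\{w_k\}_k)=\lim_{k\to\infty}w^m_k$. (Accumulation) For $f:\mathbb{N}\to\mathbb{R}_{\ge 0}$ and $g:\mathbb{N}\to M$ ($M$ a Banach space), if $n$ is such that $\sum_{i=0}^{n-1}f(i)\le 1$ and $\sum_{i=0}^{n}f(i)>1$, then $\bar\alpha(f,g)=\sum_{i=0}^{n-1}f(i)g(i)+\lambda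 g(n)$ with $\lambda=1-\sum_{i=0}^{n-1}f(i)$; $\bar\alpha(f,g)$ is undefined if $\sum_{i=0}^\infty f(i)\le 1$. **Internal computability in the given data.** The functions internally computable in $\{a_n\}$, $d$ and $d(\cdot,M)$ form the smallest class of partial functions, from products of the sets $\mathbb{N},\mathbb{R},X,M$ to any of these sets, that contains the following basic functions and constants (dummy arguments allowed; since $M\subset X$, functions with arguments in $X$ may be applied to elements of $M$): - successor and constants on $\mathbb{N}$; the constant $1$ in $\mathbb{R}$; addition, subtraction, multiplication and absolute value on $\mathbb{R}$; - $n\mapsto a_n\in M$; $d:X^2\to\mathbb{R}$; $x\mapsto d(x,M)$ from $X$ to $\mathbb{R}$; - vector addition $M^2\to M$, scalar multiplication $\mathbb{R}\times M\to M$ and the norm $M\to\mathbb{R}$; and that is closed under composition, primitive recursion (on an argument in $\mathbb{N}$, with values in any of these sets), $\mu$-recursion over $\mathbb{N}$, the Case operator, the modified limit operator for $\mathbb{R}$ and $M$, and the accumulation operator for $\mathbb{R}$ and $M$ (all with parameters: e.g. if $\varphi(n,\vec z)$ is in the class with values in $M$, so is $\vec z\mapsto ml(\{\varphi(n,\vec z)\}_n)$). *)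

theory Defs
  imports "HOL-Analysis.Analysis"
begin

text \<open>
  The subspace \<open>M\<close> of the metric space \<open>X\<close> (the type \<open>'x\<close>) carries its Banach space structure
  through a bijection \<open>\<iota> :: 'm \<Rightarrow> 'x\<close> from a Banach space \<open>'m\<close> onto \<open>M\<close>. An element of \<open>M\<close> is
  represented by its preimage in \<open>'m\<close>, and \<open>\<iota>\<close> is the inclusion of \<open>M\<close> into \<open>X\<close>.
\<close>

datatype sort = SN | SR | SX | SM

datatype ('x, 'm) val = VN nat | VR real | VX 'x | VM 'm

primrec sort_of :: "('x, 'm) val \<Rightarrow> sort" where
  "sort_of (VN n) = SN"
| "sort_of (VR r) = SR"
| "sort_of (VX x) = SX"
| "sort_of (VM u) = SM"

text \<open>
  A partial function from the product of the sorts \<open>ss\<close> is a partial function on argument lists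
  that is undefined on every list not in that product; \<open>restr ss\<close> enforces the latter.
\<close>

type_synonym ('x, 'm) pfun = "('x, 'm) val list \<Rightarrow> ('x, 'm) val option"

definition restr :: "sort list \<Rightarrow> ('x, 'm) pfun \<Rightarrow> ('x, 'm) pfun" where
  "restr ss f = f |` {vs. map sort_of vs = ss}"

definition comp_op :: "('x, 'm) pfun \<Rightarrow> ('x, 'm) pfun list \<Rightarrow> ('x, 'm) pfun" where
  "comp_op h gs vs = Option.bind (those (map (\<lambda>g. g vs) gs)) h"

definition primrec_op :: "('x, 'm) pfun \<Rightarrow> ('x, 'm) pfun \<Rightarrow> ('x, 'm) pfun" where
  "primrec_op f g vs =
    (case vs of
       VN n # ws \<Rightarrow> rec_nat (f ws) (\<lambda>k r. Option.bind r (\<lambda>v. g (VN k # v # ws))) n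
     | _ \<Rightarrow> None)"

text \<open>The search is undefined if \<open>f\<close> is undefined at an argument below the first zero.\<close>

definition mu_op :: "('x, 'm) pfun \<Rightarrow> ('x, 'm) pfun" where
  "mu_op f vs =
    (if \<exists>n. f (VN n # vs) = Some (VN 0) \<and> (\<forall>k<n. \<exists>j>0. f (VN k # vs) = Some (VN j))
     then Some (VN (LEAST n. f (VN n # vs) = Some (VN 0)))
     else None)"

text \<open>
  The arguments of the resulting function are \<open>y\<close>, \<open>x\<close> and the parameters. At \<open>x = y\<close>, if both
  sides are undefined, the equation test succeeds but the result is still undefined.
\<close>

fun case_op :: "('x, 'm) pfun \<Rightarrow> ('x, 'm) pfun \<Rightarrow> ('x, 'm) pfun" where
  "case_op f g (VR y # VR x # vs) =
    (if x < y then f (VR x # vs)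
     else if y < x then g (VR x # vs)
     else if f (VR y # vs) = g (VR y # vs) then f (VR y # vs)
     else None)"
| "case_op f g _ = None"

fun mod_seq :: "(nat \<Rightarrow> 'a::real_normed_vector) \<Rightarrow> nat \<Rightarrow> 'a" where
  "mod_seq w 0 = w 0"
| "mod_seq w (Suc k) =
    (let u = w (Suc k) - mod_seq w k;
         l = (if norm u \<le> (1/2) ^ k then 1 else (1/2) ^ k / norm u)
     in mod_seq w k + l *\<^sub>R u)"

definition mod_lim :: "(nat \<Rightarrow> 'a::real_normed_vector) \<Rightarrow> 'a" where
  "mod_lim w = lim (mod_seq w)"

text \<open>
  The index \<open>n\<close> below is unique because \<open>accum\<close> is only used for nonnegative \<open>f\<close>, and it exists
  unless the series of \<open>f\<close> has sum at most 1.
\<close>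

definition accum :: "(nat \<Rightarrow> real) \<Rightarrow> (nat \<Rightarrow> 'a::real_normed_vector) \<Rightarrow> 'a option" where
  "accum f g =
    (if \<exists>n. (\<Sum>i<n. f i) \<le> 1 \<and> (\<Sum>i\<le>n. f i) > 1
     then let n = (THE n. (\<Sum>i<n. f i) \<le> 1 \<and> (\<Sum>i\<le>n. f i) > 1)
          in Some ((\<Sum>i<n. f i *\<^sub>R g i) + (1 - (\<Sum>i<n. f i)) *\<^sub>R g n)
     else None)"

text \<open>
  \<open>C\<close> is one of the constructors \<open>VR\<close>, \<open>VM\<close>. \<open>seq_at C \<phi> vs\<close> is the sequence
  \<open>n \<mapsto> \<phi>(n, vs)\<close>, provided that \<open>\<phi>(n, vs)\<close> is defined for every \<open>n\<close>.
\<close>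

definition seq_at ::
  "('a \<Rightarrow> ('x, 'm) val) \<Rightarrow> ('x, 'm) pfun \<Rightarrow> ('x, 'm) val list \<Rightarrow> (nat \<Rightarrow> 'a) option" where
  "seq_at C \<phi> vs =
    (if \<exists>w. \<forall>n. \<phi> (VN n # vs) = Some (C (w n))
     then Some (THE w. \<forall>n. \<phi> (VN n # vs) = Some (C (w n)))
     else None)"

definition ml_op ::
  "('a::real_normed_vector \<Rightarrow> ('x, 'm) val) \<Rightarrow> ('x, 'm) pfun \<Rightarrow> ('x, 'm) pfun" where
  "ml_op C \<phi> vs = map_option (\<lambda>w. C (mod_lim w)) (seq_at C \<phi> vs)"

definition accum_op ::
  "('a::real_normed_vector \<Rightarrow> ('x, 'm) val) \<Rightarrow>
   ('x, 'm) pfun \<Rightarrow> ('x, 'm) pfun \<Rightarrow> ('x, 'm) pfun" where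
  "accum_op C \<psi> \<phi> vs =
    (case (seq_at VR \<psi> vs, seq_at C \<phi> vs) of
       (Some f, Some g) \<Rightarrow> if \<forall>n. f n \<ge> 0 then map_option C (accum f g) else None
     | _ \<Rightarrow> None)"

text \<open>
  \<open>int_computable \<iota> M a ss t f\<close>: the partial function \<open>f\<close> from the product of the sorts \<open>ss\<close> to
  the sort \<open>t\<close> is internally computable in \<open>a\<close>, \<open>d\<close> and \<open>d(\<cdot>, M)\<close>. Dummy arguments, and
  permutation and identification of arguments, are obtained from \<open>proj\<close> and \<open>comp\<close>; the
  application of functions on \<open>X\<close> to elements of \<open>M\<close> is obtained from \<open>incl\<close> and \<open>comp\<close>.
\<close>

inductive int_computable ::
  "('m::banach \<Rightarrow> 'x::metric_space) \<Rightarrow> 'x set \<Rightarrow> (nat \<Rightarrow> 'm) \<Rightarrow>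
   sort list \<Rightarrow> sort \<Rightarrow> ('x, 'm) pfun \<Rightarrow> bool"
  for \<iota> M a where
  proj: "i < length ss \<Longrightarrow>
    int_computable \<iota> M a ss (ss ! i) (restr ss (\<lambda>vs. Some (vs ! i)))"
| incl: "int_computable \<iota> M a [SM] SX (\<lambda>vs. case vs of [VM u] \<Rightarrow> Some (VX (\<iota> u)) | _ \<Rightarrow> None)"
| nat_suc: "int_computable \<iota> M a [SN] SN (\<lambda>vs. case vs of [VN n] \<Rightarrow> Some (VN (Suc n)) | _ \<Rightarrow> None)"
| nat_const: "int_computable \<iota> M a [] SN (restr [] (\<lambda>_. Some (VN c)))"
| real_one: "int_computable \<iota> M a [] SR (restr [] (\<lambda>_. Some (VR 1)))"
| real_add: "int_computable \<iota> M a [SR, SR] SR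
    (\<lambda>vs. case vs of [VR r, VR s] \<Rightarrow> Some (VR (r + s)) | _ \<Rightarrow> None)"
| real_diff: "int_computable \<iota> M a [SR, SR] SR
    (\<lambda>vs. case vs of [VR r, VR s] \<Rightarrow> Some (VR (r - s)) | _ \<Rightarrow> None)"
| real_mult: "int_computable \<iota> M a [SR, SR] SR
    (\<lambda>vs. case vs of [VR r, VR s] \<Rightarrow> Some (VR (r * s)) | _ \<Rightarrow> None)"
| real_abs: "int_computable \<iota> M a [SR] SR
    (\<lambda>vs. case vs of [VR r] \<Rightarrow> Some (VR \<bar>r\<bar>) | _ \<Rightarrow> None)"
| enum: "int_computable \<iota> M a [SN] SM
    (\<lambda>vs. case vs of [VN n] \<Rightarrow> Some (VM (a n)) | _ \<Rightarrow> None)"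
| metric: "int_computable \<iota> M a [SX, SX] SR
    (\<lambda>vs. case vs of [VX x, VX y] \<Rightarrow> Some (VR (dist x y)) | _ \<Rightarrow> None)"
| dist_M: "int_computable \<iota> M a [SX] SR
    (\<lambda>vs. case vs of [VX x] \<Rightarrow> Some (VR (infdist x M)) | _ \<Rightarrow> None)"
| vec_add: "int_computable \<iota> M a [SM, SM] SM
    (\<lambda>vs. case vs of [VM u, VM v] \<Rightarrow> Some (VM (u + v)) | _ \<Rightarrow> None)"
| vec_scale: "int_computable \<iota> M a [SR, SM] SM
    (\<lambda>vs. case vs of [VR r, VM u] \<Rightarrow> Some (VM (r *\<^sub>R u)) | _ \<Rightarrow> None)"
| vec_norm: "int_computable \<iota> M a [SM] SR
    (\<lambda>vs. case vs of [VM u] \<Rightarrow> Some (VR (norm u)) | _ \<Rightarrow> None)"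
| comp: "int_computable \<iota> M a rs t h \<Longrightarrow> list_all2 (int_computable \<iota> M a ss) rs gs \<Longrightarrow>
    int_computable \<iota> M a ss t (restr ss (comp_op h gs))"
| prim_rec: "int_computable \<iota> M a ss t f \<Longrightarrow> int_computable \<iota> M a (SN # t # ss) t g \<Longrightarrow>
    int_computable \<iota> M a (SN # ss) t (restr (SN # ss) (primrec_op f g))"
| mu_rec: "int_computable \<iota> M a (SN # ss) SN f \<Longrightarrow>
    int_computable \<iota> M a ss SN (restr ss (mu_op f))"
| case_of: "int_computable \<iota> M a (SR # ss) t f \<Longrightarrow> int_computable \<iota> M a (SR # ss) t g \<Longrightarrow>
    int_computable \<iota> M a (SR # SR # ss) t (restr (SR # SR # ss) (case_op f g))"
| ml_real: "int_computable \<iota> M a (SN # ss) SR \<phi> \<Longrightarrow>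
    int_computable \<iota> M a ss SR (restr ss (ml_op VR \<phi>))"
| ml_M: "int_computable \<iota> M a (SN # ss) SM \<phi> \<Longrightarrow>
    int_computable \<iota> M a ss SM (restr ss (ml_op VM \<phi>))"
| accum_real: "int_computable \<iota> M a (SN # ss) SR \<psi> \<Longrightarrow> int_computable \<iota> M a (SN # ss) SR \<phi> \<Longrightarrow>
    int_computable \<iota> M a ss SR (restr ss (accum_op VR \<psi> \<phi>))"
| accum_M: "int_computable \<iota> M a (SN # ss) SR \<psi> \<Longrightarrow> int_computable \<iota> M a (SN # ss) SM \<phi> \<Longrightarrow>
    int_computable \<iota> M a ss SM (restr ss (accum_op VM \<psi> \<phi>))"
monos list_all2_mono

definition int_computable_fun ::
  "('m::banach \<Rightarrow> 'x::metric_space) \<Rightarrow> 'x set \<Rightarrow> (nat \<Rightarrow> 'm) \<Rightarrow> ('x \<Rightarrow> 'm) \<Rightarrow> bool" where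
  "int_computable_fun \<iota> M a g \<longleftrightarrow>
    int_computable \<iota> M a [SX] SM (\<lambda>vs. case vs of [VX x] \<Rightarrow> Some (VM (g x)) | _ \<Rightarrow> None)"

end

theory Submission
  imports Defs
begin

text \<open>
  The retraction is a Dugundji-type extension of the identity of \<open>M\<close>, carried out at every
  precision. For \<open>k \<in> \<nat>\<close> give the \<open>n\<close>-th term of the
  dense sequence the weight \<open>b\<^sub>k\<^sub>n(x) = t + \<bar>t\<bar>\<close> with
  \<open>t = 1 + 2^(k+1) (d(x,M) - d(x,a\<^sub>n))\<close>, and let \<open>w\<^sub>k(x)\<close> be the
  accumulation of the \<open>a\<^sub>n\<close> with these weights. The weight of \<open>a\<^sub>n\<close> is positive only if
  \<open>a\<^sub>n\<close> is closer to \<open>x\<close> than \<open>d(x,M) + 1/2^(k+1)\<close>, and it exceeds 1 as soon as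
  \<open>a\<^sub>n\<close> is closer than \<open>d(x,M) + 1/2^(k+2)\<close>. Because the sequence is dense in \<open>M\<close>,
  the latter happens for some \<open>n\<close>, so the accumulation is defined at every point of \<open>X\<close>, in
  \<open>M\<close> and outside it alike: the slack \<open>1/2^(k+1)\<close> lets one formula serve for both.

  The value \<open>w\<^sub>k(x)\<close> is a convex combination of points \<open>a\<^sub>n\<close> of positive weight. On
  \<open>M\<close> these lie within \<open>1/2^(k+1)\<close> of \<open>x\<close>, hence so does \<open>w\<^sub>k(x)\<close>; consecutive
  terms then differ by at most \<open>1/2^k\<close>, the modified limit does not alter the sequence, and
  \<open>g(x) = ml (w\<^sub>k(x))\<close> equals \<open>x\<close> (\<open>approx_retraction_near\<close>, \<open>mod_lim_eq\<close>).

  For continuity, accumulation depends continuously on its weights, because the coefficients of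
  the convex combination are the increments of the partial sums truncated at 1
  (\<open>continuous_on_accum\<close>). The modified sequence moves by at most \<open>1/2^k\<close> in step \<open>k\<close>
  wherever it is evaluated, so it converges uniformly on \<open>X\<close> whatever the \<open>w\<^sub>k\<close> do off
  \<open>M\<close>, and the modified limit of continuous functions is continuous
  (\<open>continuous_on_mod_lim\<close>).

  The construction of \<open>g\<close> uses arithmetic without division, the given functions, one
  primitive recursion (for \<open>2^k\<close>), one accumulation and one modified limit; the intermediate
  functions are total, which allows composing them as ordinary functions
  (\<open>total_computable_comp\<close>).
\<close>

section \<open>Continuity and value of the modified limit\<close>

lemma mod_seq_step: "norm (mod_seq w (Suc k) - mod_seq w k) \<le> (1/2) ^ k"
  by (simp add: Let_def)

text \<open>
  Writing the step length as a quotient with a positive denominator replaces the distinction of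
  cases by an expression that is visibly continuous.
\<close>

lemma mod_seq_Suc_max:
  "mod_seq w (Suc k) = mod_seq w k +
    ((1/2) ^ k / max ((1/2) ^ k) (norm (w (Suc k) - mod_seq w k))) *\<^sub>R (w (Suc k) - mod_seq w k)"
  by (simp add: Let_def max_def)

lemma continuous_on_mod_seq:
  assumes "\<And>k. continuous_on S (w k)"
  shows "continuous_on S (\<lambda>x. mod_seq (\<lambda>k. w k x) k)"
proof (induction k)
  case 0
  then show ?case by (simp add: assms)
next
  case (Suc k)
  have "max ((1/2) ^ k) (norm (w (Suc k) x - mod_seq (\<lambda>k. w k x) k)) \<noteq> (0::real)" for x
    by (metis less_max_iff_disj order_less_irrefl zero_less_divide_1_iff zero_less_numeral zero_less_power)
  then show ?case
    unfolding mod_seq_Suc_max by (intro continuous_intros Suc assms) auto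
qed

text \<open>
  The bound on the steps does not depend on the point, so the Weierstrass test applies to the
  telescoping series of the steps.
\<close>

lemma uniform_limit_mod_seq:
  fixes w :: "nat \<Rightarrow> 'x \<Rightarrow> 'm::banach"
  shows "uniform_limit S (\<lambda>n x. mod_seq (\<lambda>k. w k x) n) (\<lambda>x. mod_lim (\<lambda>k. w k x)) sequentially"
proof -
  define s where "s k x = mod_seq (\<lambda>k. w k x) (Suc k) - mod_seq (\<lambda>k. w k x) k" for k x
  have "uniformly_convergent_on S (\<lambda>n x. \<Sum>k<n. s k x)"
    using mod_seq_step by (intro Weierstrass_m_test'[of _ _ "\<lambda>k. (1/2) ^ k"]) (auto simp: s_def summable_geometric)
  then obtain l where "uniform_limit S (\<lambda>n x. \<Sum>k<n. s k x) l sequentially"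
    by (auto simp: uniformly_convergent_on_def)
  then have "uniform_limit S (\<lambda>n x. w 0 x + (\<Sum>k<n. s k x)) (\<lambda>x. w 0 x + l x) sequentially"
    by (intro uniform_limit_intros)
  then have ul: "uniform_limit S (\<lambda>n x. mod_seq (\<lambda>k. w k x) n) (\<lambda>x. w 0 x + l x) sequentially"
    unfolding s_def sum_lessThan_telescope by simp
  have "mod_lim (\<lambda>k. w k x) = w 0 x + l x" if "x \<in> S" for x
    unfolding mod_lim_def by (intro limI tendsto_uniform_limitI[OF ul that])
  then show ?thesis
    using ul by (simp cong: uniform_limit_cong')
qed

lemma continuous_on_mod_lim:
  fixes w :: "nat \<Rightarrow> 'x::topological_space \<Rightarrow> 'm::banach"
  assumes "\<And>k. continuous_on S (w k)"
  shows "continuous_on S (\<lambda>x. mod_lim (\<lambda>k. w k x))"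
  by (rule uniform_limit_theorem[OF _ uniform_limit_mod_seq])
    (auto intro!: always_eventually continuous_on_mod_seq assms)

text \<open>
  Two terms within \<open>1/2^(k+1)\<close> and \<open>1/2^(k+2)\<close> of the same point differ by at most
  \<open>1/2^k\<close>, so no step gets shortened.
\<close>

lemma mod_lim_eq:
  assumes close: "\<And>k. norm (w k - u) \<le> (1/2) ^ Suc k"
  shows "mod_lim w = u"
proof -
  have "norm (w (Suc k) - w k) \<le> (1/2) ^ k" for k
  proof -
    have "norm (w (Suc k) - w k) \<le> norm (w (Suc k) - u) + norm (w k - u)"
      using norm_triangle_ineq4[of "w (Suc k) - u" "w k - u"] by simp
    also have "\<dots> \<le> (1/2) ^ Suc (Suc k) + (1/2) ^ Suc k"
      by (intro add_mono close)
    also have "\<dots> \<le> (1/2) ^ k"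
      by simp
    finally show ?thesis .
  qed
  then have "mod_seq w k = w k" for k
    by (induction k) (simp_all add: Let_def)
  moreover have "w \<longlonglongrightarrow> u"
  proof (rule LIM_zero_cancel, rule Lim_null_comparison)
    show "\<forall>\<^sub>F k in sequentially. norm (w k - u) \<le> (1/2) ^ Suc k"
      by (intro always_eventually allI close)
    show "(\<lambda>k. (1/2::real) ^ Suc k) \<longlonglongrightarrow> 0"
      by (intro LIMSEQ_Suc LIMSEQ_power_zero) simp
  qed
  moreover have "mod_seq w = w" using calculation(1) by blast
  ultimately show ?thesis
    unfolding mod_lim_def by (simp add: limI)
qed

section \<open>Accumulation as a continuous convex combination\<close>

text \<open>
  Stopping the accumulation when the partial sums reach 1 amounts to truncating the partial sums
  at 1: below the stopping index the increment is the full weight, at that index it is the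
  remainder, and above it vanishes.
\<close>

definition accum_weight :: "(nat \<Rightarrow> real) \<Rightarrow> nat \<Rightarrow> real" where
  "accum_weight f i = min 1 (\<Sum>j<Suc i. f j) - min 1 (\<Sum>j<i. f j)"

lemma accum_weight_nonneg: "f i \<ge> 0 \<Longrightarrow> accum_weight f i \<ge> 0"
  by (simp add: accum_weight_def)

lemma accum_weight_eq_0: "f i = 0 \<Longrightarrow> accum_weight f i = 0"
  by (simp add: accum_weight_def)

lemma sum_accum_weight: "(\<Sum>i<N. accum_weight f i) = min 1 (\<Sum>j<N. f j)"
  unfolding accum_weight_def by (subst sum_lessThan_telescope) simp

text \<open>
  The point of this formula is that any \<open>N\<close> beyond the stopping index may be used, so
  that one \<open>N\<close> serves for a whole neighbourhood when the weights vary with a parameter.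
\<close>

lemma accum_eq_weighted_sum:
  fixes g :: "nat \<Rightarrow> 'm::real_normed_vector"
  assumes nonneg: "\<And>i. f i \<ge> 0" and N: "(\<Sum>i<N. f i) > 1"
  shows "accum f g = Some (\<Sum>i<N. accum_weight f i *\<^sub>R g i)"
proof -
  define S where "S n = (\<Sum>i<n. f i)" for n
  have mono: "S m \<le> S n" if "m \<le> n" for m n
    unfolding S_def using that nonneg by (intro sum_mono2) auto
  have "\<exists>n<N. (\<forall>i\<le>n. \<not> S i > 1) \<and> S (Suc n) > 1"
    using ex_least_nat_less[of "\<lambda>n. S n > 1" N] N by (auto simp: S_def)
  then obtain n where n: "n < N" "S n \<le> 1" "S (Suc n) > 1"
    by (auto simp: not_less)
  have n_unique: "m = n" if "S m \<le> 1" "S (Suc m) > 1" for m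
    using n that mono[of "Suc m" n] mono[of "Suc n" m] by (meson not_less_eq_eq linorder_not_less order_antisym order_trans)
  then have "(THE n. S n \<le> 1 \<and> S (Suc n) > 1) = n"
    using n by blast
  then have "accum f g = Some ((\<Sum>i<n. f i *\<^sub>R g i) + (1 - S n) *\<^sub>R g n)"
    using n unfolding accum_def S_def lessThan_Suc_atMost Let_def by auto
  \<comment> \<open>Beyond index \<open>n\<close> both truncated partial sums are 1.\<close>
  moreover have "(\<Sum>i<N. accum_weight f i *\<^sub>R g i) = (\<Sum>i<Suc n. accum_weight f i *\<^sub>R g i)"
  proof (rule sum.mono_neutral_right)
    show "\<forall>i\<in>{..<N} - {..<Suc n}. accum_weight f i *\<^sub>R g i = 0"
    proof
      fix i assume "i \<in> {..<N} - {..<Suc n}"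
      then have "S i > 1" "S (Suc i) > 1"
        using n(3) mono[of "Suc n" i] mono[of "Suc n" "Suc i"] by auto
      then show "accum_weight f i *\<^sub>R g i = 0"
        unfolding accum_weight_def S_def by simp
    qed
  qed (use n in auto)
  moreover have "accum_weight f i = f i" if "i < n" for i
    using mono[of i n] mono[of "Suc i" n] that n(2) unfolding accum_weight_def S_def by simp
  moreover have "accum_weight f n = 1 - S n"
    using n unfolding accum_weight_def S_def by simp
  ultimately show ?thesis
    by simp
qed

text \<open>
  The coefficients sum to 1, because the partial sums pass 1, and vanish with the weights; so the
  value is a convex combination of points in the ball of radius \<open>r\<close> around \<open>u\<close>.
\<close>

lemma norm_accum_diff_le:
  fixes g :: "nat \<Rightarrow> 'm::real_normed_vector"
  assumes nonneg: "\<And>i. f i \<ge> 0" and N: "(\<Sum>i<N. f i) > 1"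
    and close: "\<And>i. f i > 0 \<Longrightarrow> norm (g i - u) \<le> r"
  shows "norm (the (accum f g) - u) \<le> r"
proof -
  have sum1: "(\<Sum>i<N. accum_weight f i) = 1"
    using N by (simp add: sum_accum_weight)
  have "the (accum f g) - u = (\<Sum>i<N. accum_weight f i *\<^sub>R (g i - u))"
    using sum1 by (simp add: accum_eq_weighted_sum[OF nonneg N] scaleR_diff_right sum_subtractf
        flip: scaleR_sum_left)
  also have "norm \<dots> \<le> (\<Sum>i<N. accum_weight f i * r)"
  proof (intro sum_norm_le)
    fix i
    show "norm (accum_weight f i *\<^sub>R (g i - u)) \<le> accum_weight f i * r"
      using close[of i] nonneg[of i] accum_weight_nonneg[of f i] accum_weight_eq_0[of f i]
      by (cases "f i = 0") (auto intro: mult_left_mono)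
  qed
  also have "\<dots> = r"
    using sum1 by (simp flip: sum_distrib_right)
  finally show ?thesis .
qed

text \<open>
  The stopping index may jump with \<open>x\<close>, but an \<open>N\<close> with partial sum above 1 at \<open>x\<close>
  still works near \<open>x\<close>, where the value is then a fixed finite sum of continuous functions.
\<close>

lemma continuous_on_accum:
  fixes f :: "nat \<Rightarrow> 'x::t2_space \<Rightarrow> real" and g :: "nat \<Rightarrow> 'm::real_normed_vector"
  assumes nonneg: "\<And>i x. f i x \<ge> 0"
    and cont: "\<And>i. continuous_on UNIV (f i)"
    and large: "\<And>x. \<exists>N. (\<Sum>i<N. f i x) > 1"
  shows "continuous_on UNIV (\<lambda>x. the (accum (\<lambda>i. f i x) g))"
proof (rule continuous_at_imp_continuous_on, rule ballI)
  fix x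
  obtain N where N: "(\<Sum>i<N. f i x) > 1"
    using large by blast
  let ?S = "{y. (\<Sum>i<N. f i y) > 1}"
  have "open ?S"
    by (intro open_Collect_less continuous_intros cont)
  then have "\<forall>\<^sub>F y in nhds x. y \<in> ?S"
    using N by (intro eventually_nhds_in_open) auto
  then have "\<forall>\<^sub>F y in nhds x.
      the (accum (\<lambda>i. f i y) g) = (\<Sum>i<N. accum_weight (\<lambda>i. f i y) i *\<^sub>R g i)"
    by (rule eventually_mono) (simp add: accum_eq_weighted_sum nonneg)
  moreover have "continuous_on UNIV (\<lambda>y. \<Sum>i<N. accum_weight (\<lambda>i. f i y) i *\<^sub>R g i)"
    unfolding accum_weight_def by (intro continuous_intros cont)
  then have "isCont (\<lambda>y. \<Sum>i<N. accum_weight (\<lambda>i. f i y) i *\<^sub>R g i) x"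
    by (simp add: continuous_on_eq_continuous_at)
  ultimately show "isCont (\<lambda>x. the (accum (\<lambda>i. f i x) g)) x"
    by (simp add: isCont_cong)
qed

section \<open>Dense sequences\<close>

lemma dense_approx_infdist:
  fixes \<iota> :: "'m::metric_space \<Rightarrow> 'x::metric_space" and a :: "nat \<Rightarrow> 'm"
  assumes "range \<iota> = M" "\<And>u v. dist (\<iota> u) (\<iota> v) = dist u v"
    and "closure (range a) = UNIV" "\<epsilon> > 0"
  shows "\<exists>n. dist x (\<iota> (a n)) < infdist x M + \<epsilon>"
proof -
  have "M \<noteq> {}" using assms(1) by auto
  then have "infdist x M = (INF y\<in>M. dist x y)" by (rule infdist_notempty)
  moreover have "(INF y\<in>M. dist x y) < infdist x M + \<epsilon> / 2"
    using assms(4) calculation by simp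
  ultimately obtain y where "y \<in> M" "dist x y < infdist x M + \<epsilon> / 2"
    using cInf_lessD[of "dist x ` M" "infdist x M + \<epsilon> / 2"] \<open>M \<noteq> {}\<close> by auto
  moreover obtain u where "y = \<iota> u"
    using \<open>y \<in> M\<close> assms(1) by blast
  moreover obtain n where "dist (a n) u < \<epsilon> / 2"
    using assms(3,4) closure_approachable[of u "range a"] by (metis UNIV_I half_gt_zero rangeE)
  ultimately have "dist x (\<iota> (a n)) < infdist x M + \<epsilon>"
    using dist_triangle[of x "\<iota> (a n)" "\<iota> u"] assms(2)[of u "a n"] by (simp add: dist_commute)
  then show ?thesis ..
qed

text \<open>
  A dense set \<open>C\<close> of \<open>X\<close> need not meet \<open>M\<close>. Choosing for each \<open>p \<in> C\<close> and
  each \<open>n\<close> a point of \<open>M\<close> closer to \<open>p\<close> than \<open>1/(n+1)\<close>, if there is one, still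
  gives a countable dense set of \<open>M\<close>: a point of \<open>M\<close> near \<open>p\<close> witnesses that the
  choice is possible.
\<close>

lemma separable_dense_sequence:
  fixes \<iota> :: "'m::metric_space \<Rightarrow> 'x::metric_space"
  assumes "separable_space (euclidean :: 'x topology)"
    and iso: "\<And>u v. dist (\<iota> u) (\<iota> v) = dist u v"
  shows "\<exists>a :: nat \<Rightarrow> 'm. closure (range a) = UNIV"
proof -
  obtain C :: "'x set" where C: "countable C" "closure C = UNIV"
    using assms(1) by (auto simp: separable_space_def)
  define c where "c p = (SOME u. dist (fst p) (\<iota> u) < inverse (real (Suc (snd p))))" for p
  let ?D = "c ` (C \<times> UNIV)"
  have "countable ?D" "?D \<noteq> {}"
    using C by (auto intro: countable_SIGMA)
  then obtain a :: "nat \<Rightarrow> 'm" where a: "range a = ?D"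
    by (metis range_from_nat_into)
  have "u \<in> closure ?D" for u
    unfolding closure_approachable
  proof (intro allI impI)
    fix \<epsilon> :: real assume "\<epsilon> > 0"
    then obtain n where n: "inverse (real (Suc n)) < \<epsilon> / 2"
      using reals_Archimedean half_gt_zero by blast
    obtain p where p: "p \<in> C" "dist p (\<iota> u) < inverse (real (Suc n))"
      using C(2) closure_approachable[of "\<iota> u" C] by (metis UNIV_I inverse_positive_iff_positive of_nat_0_less_iff zero_less_Suc)
    have "dist p (\<iota> (c (p, n))) < inverse (real (Suc n))"
      unfolding c_def using p(2) by simp (rule someI)
    then have "dist (\<iota> (c (p, n))) (\<iota> u) < \<epsilon>"
      using p(2) n dist_triangle[of "\<iota> (c (p, n))" "\<iota> u" p] by (simp add: dist_commute)
    then show "\<exists>v\<in>?D. dist v u < \<epsilon>"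
      using p(1) iso by force
  qed
  then show ?thesis
    using a by (metis UNIV_eq_I)
qed

section \<open>Computable total functions\<close>

text \<open>
  An equation between partial functions on argument lists is needed after every application of a
  closure rule. For functions that are defined on the whole product of their argument sorts, it
  reduces to an equation between values, and a computable function can be given by a formula in the
  arguments.
\<close>

definition total_computable ::
  "('m::banach \<Rightarrow> 'x::metric_space) \<Rightarrow> 'x set \<Rightarrow> (nat \<Rightarrow> 'm) \<Rightarrow>
   sort list \<Rightarrow> sort \<Rightarrow> (('x, 'm) val list \<Rightarrow> ('x, 'm) val) \<Rightarrow> bool" where
  "total_computable \<iota> M a ss t F \<longleftrightarrow> int_computable \<iota> M a ss t (restr ss (\<lambda>vs. Some (F vs)))"

lemma total_computable_cong:
  assumes "\<And>vs. map sort_of vs = ss \<Longrightarrow> F vs = G vs"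
  shows "total_computable \<iota> M a ss t F \<longleftrightarrow> total_computable \<iota> M a ss t G"
proof -
  have "restr ss (\<lambda>vs. Some (F vs)) = restr ss (\<lambda>vs. Some (G vs))"
    using assms by (auto simp: restr_def restrict_map_def fun_eq_iff)
  then show ?thesis
    by (simp add: total_computable_def)
qed

lemma total_computable_proj:
  assumes "i < length ss" "t = ss ! i" "\<And>vs. map sort_of vs = ss \<Longrightarrow> F vs = vs ! i"
  shows "total_computable \<iota> M a ss t F"
  using proj[OF assms(1)] assms(2) total_computable_cong[of ss F "\<lambda>vs. vs ! i", OF assms(3)]
  by (simp add: total_computable_def)

lemma those_map_restr:
  assumes "map sort_of vs = ss"
  shows "those (map (\<lambda>g. g vs) (map (\<lambda>G. restr ss (\<lambda>vs. Some (G vs))) Gs)) =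
    Some (map (\<lambda>G. G vs) Gs)"
  using assms by (induction Gs) (auto simp: restr_def)

text \<open>
  The outer function is an arbitrary computable partial function, so the lemma applies
  directly to the basic functions in the form in which they occur in the inductive definition.
\<close>

lemma total_computable_comp:
  assumes h: "int_computable \<iota> M a rs t h"
    and Gs: "list_all2 (total_computable \<iota> M a ss) rs Gs"
    and F: "\<And>vs. map sort_of vs = ss \<Longrightarrow> h (map (\<lambda>G. G vs) Gs) = Some (F vs)"
  shows "total_computable \<iota> M a ss t F"
proof -
  let ?gs = "map (\<lambda>G. restr ss (\<lambda>vs. Some (G vs))) Gs"
  have "restr ss (comp_op h ?gs) = restr ss (\<lambda>vs. Some (F vs))"
  proof
    fix vs
    show "restr ss (comp_op h ?gs) vs = restr ss (\<lambda>vs. Some (F vs)) vs"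
    proof (cases "map sort_of vs = ss")
      case True
      then show ?thesis
        using F[OF True] by (simp add: restr_def[of _ "comp_op h ?gs"] restr_def[of _ "\<lambda>vs. Some (F vs)"]
            comp_op_def those_map_restr[OF True] del: map_map)
    qed (simp add: restr_def)
  qed
  moreover have "list_all2 (int_computable \<iota> M a ss) rs ?gs"
    using Gs by (simp add: list_all2_conv_all_nth total_computable_def)
  ultimately show ?thesis
    using int_computable.comp[OF h] unfolding total_computable_def by metis
qed

lemma total_computable_one: "total_computable \<iota> M a ss SR (\<lambda>vs. VR 1)"
  by (rule total_computable_comp[OF real_one, where Gs = "[]"]) (auto simp: restr_def)

lemma total_computable_add:
  assumes "total_computable \<iota> M a ss SR (\<lambda>vs. VR (r vs))"
    and "total_computable \<iota> M a ss SR (\<lambda>vs. VR (s vs))"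
  shows "total_computable \<iota> M a ss SR (\<lambda>vs. VR (r vs + s vs))"
  by (rule total_computable_comp[OF real_add,
        where Gs = "[\<lambda>vs. VR (r vs), \<lambda>vs. VR (s vs)]"]) (use assms in auto)

lemma total_computable_diff:
  assumes "total_computable \<iota> M a ss SR (\<lambda>vs. VR (r vs))"
    and "total_computable \<iota> M a ss SR (\<lambda>vs. VR (s vs))"
  shows "total_computable \<iota> M a ss SR (\<lambda>vs. VR (r vs - s vs))"
  by (rule total_computable_comp[OF real_diff,
        where Gs = "[\<lambda>vs. VR (r vs), \<lambda>vs. VR (s vs)]"]) (use assms in auto)

lemma total_computable_mult:
  assumes "total_computable \<iota> M a ss SR (\<lambda>vs. VR (r vs))"
    and "total_computable \<iota> M a ss SR (\<lambda>vs. VR (s vs))"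
  shows "total_computable \<iota> M a ss SR (\<lambda>vs. VR (r vs * s vs))"
  by (rule total_computable_comp[OF real_mult,
        where Gs = "[\<lambda>vs. VR (r vs), \<lambda>vs. VR (s vs)]"]) (use assms in auto)

lemma total_computable_abs:
  assumes "total_computable \<iota> M a ss SR (\<lambda>vs. VR (r vs))"
  shows "total_computable \<iota> M a ss SR (\<lambda>vs. VR \<bar>r vs\<bar>)"
  by (rule total_computable_comp[OF real_abs, where Gs = "[\<lambda>vs. VR (r vs)]"]) (use assms in auto)

lemma total_computable_dist:
  assumes "total_computable \<iota> M a ss SX (\<lambda>vs. VX (x vs))"
    and "total_computable \<iota> M a ss SX (\<lambda>vs. VX (y vs))"
  shows "total_computable \<iota> M a ss SR (\<lambda>vs. VR (dist (x vs) (y vs)))"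
  by (rule total_computable_comp[OF metric,
        where Gs = "[\<lambda>vs. VX (x vs), \<lambda>vs. VX (y vs)]"]) (use assms in auto)

lemma total_computable_infdist:
  assumes "total_computable \<iota> M a ss SX (\<lambda>vs. VX (x vs))"
  shows "total_computable \<iota> M a ss SR (\<lambda>vs. VR (infdist (x vs) M))"
  by (rule total_computable_comp[OF dist_M, where Gs = "[\<lambda>vs. VX (x vs)]"]) (use assms in auto)

lemma total_computable_enum:
  assumes "total_computable \<iota> M a ss SN (\<lambda>vs. VN (n vs))"
  shows "total_computable \<iota> M a ss SM (\<lambda>vs. VM (a (n vs)))"
  by (rule total_computable_comp[OF enum, where Gs = "[\<lambda>vs. VN (n vs)]"]) (use assms in auto)

lemma total_computable_incl:
  assumes "total_computable \<iota> M a ss SM (\<lambda>vs. VM (u vs))"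
  shows "total_computable \<iota> M a ss SX (\<lambda>vs. VX (\<iota> (u vs)))"
  by (rule total_computable_comp[OF incl, where Gs = "[\<lambda>vs. VM (u vs)]"]) (use assms in auto)

primrec the_nat :: "('x, 'm) val \<Rightarrow> nat" where "the_nat (VN n) = n"
primrec the_real :: "('x, 'm) val \<Rightarrow> real" where "the_real (VR r) = r"
primrec the_point :: "('x, 'm) val \<Rightarrow> 'x" where "the_point (VX x) = x"

lemma sort_of_cases:
  "sort_of v = SN \<longleftrightarrow> (\<exists>n. v = VN n)" "sort_of v = SR \<longleftrightarrow> (\<exists>r. v = VR r)"
  "sort_of v = SX \<longleftrightarrow> (\<exists>x. v = VX x)"
  by (cases v; simp)+

lemma VN_the_nat: "sort_of v = SN \<Longrightarrow> VN (the_nat v) = v"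
  and VR_the_real: "sort_of v = SR \<Longrightarrow> VR (the_real v) = v"
  and VX_the_point: "sort_of v = SX \<Longrightarrow> VX (the_point v) = v"
  by (cases v; simp)+

lemma total_computable_nat_arg:
  assumes "i < length ss" "ss ! i = SN"
  shows "total_computable \<iota> M a ss SN (\<lambda>vs. VN (the_nat (vs ! i)))"
  using assms by (intro total_computable_proj[of i]) (auto intro!: VN_the_nat)

lemma total_computable_real_arg:
  assumes "i < length ss" "ss ! i = SR"
  shows "total_computable \<iota> M a ss SR (\<lambda>vs. VR (the_real (vs ! i)))"
  using assms by (intro total_computable_proj[of i]) (auto intro!: VR_the_real)

lemma total_computable_point_arg:
  assumes "i < length ss" "ss ! i = SX"
  shows "total_computable \<iota> M a ss SX (\<lambda>vs. VX (the_point (vs ! i)))"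
  using assms by (intro total_computable_proj[of i]) (auto intro!: VX_the_point)

text \<open>
  The arithmetic operations turn the constant 1 into integers only, so the precision enters the
  weights through a factor \<open>2^k\<close> rather than through a summand \<open>1/2^k\<close>, which would take
  another limit.
\<close>

lemma total_computable_power2:
  assumes "total_computable \<iota> M a ss SN (\<lambda>vs. VN (k vs))"
  shows "total_computable \<iota> M a ss SR (\<lambda>vs. VR (2 ^ k vs))"
proof (rule total_computable_comp[where Gs = "[\<lambda>vs. VN (k vs)]"])
  let ?f = "restr [] (\<lambda>vs. Some (VR 1))"
  let ?g = "restr [SN, SR] (\<lambda>vs. Some (VR (the_real (vs ! 1) + the_real (vs ! 1))))"
  have "total_computable \<iota> M a [SN, SR] SR (\<lambda>vs. VR (the_real (vs ! 1) + the_real (vs ! 1)))"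
    by (intro total_computable_add total_computable_real_arg) auto
  then show "int_computable \<iota> M a [SN] SR (restr [SN] (primrec_op ?f ?g))"
    using total_computable_one[of \<iota> M a "[]"]
    unfolding total_computable_def by (intro prim_rec)
  have "restr [SN] (primrec_op ?f ?g) [VN n] = Some (VR (2 ^ n))" for n
    by (induction n) (auto simp: primrec_op_def restr_def)
  then show "restr [SN] (primrec_op ?f ?g) (map (\<lambda>G. G vs) [\<lambda>vs. VN (k vs)]) = Some (VR (2 ^ k vs))"
    for vs by (simp only: list.map)
qed (use assms in auto)

lemma seq_at_total:
  assumes "inj C" "\<And>n. \<phi> (VN n # vs) = Some (C (w n))"
  shows "seq_at C \<phi> vs = Some w"
proof -
  have "w' = w" if "\<forall>n. \<phi> (VN n # vs) = Some (C (w' n))" for w'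
    using that assms by (auto simp: fun_eq_iff inj_eq)
  then have "(THE w. \<forall>n. \<phi> (VN n # vs) = Some (C (w n))) = w"
    using assms(2) by (intro the_equality) blast+
  then show ?thesis
    using assms(2) unfolding seq_at_def by auto
qed

text \<open>
  Both limiting operators add the index of the sequence as first argument, which is why the
  sequence is expressed by the head and the tail of the argument list.
\<close>

lemma total_computable_mod_lim:
  assumes "total_computable \<iota> M a (SN # ss) SM (\<lambda>vs. VM (w (the_nat (hd vs)) (tl vs)))"
  shows "total_computable \<iota> M a ss SM (\<lambda>vs. VM (mod_lim (\<lambda>n. w n vs)))"
proof -
  let ?\<phi> = "restr (SN # ss) (\<lambda>vs. Some (VM (w (the_nat (hd vs)) (tl vs))))"
  have seq: "seq_at VM ?\<phi> vs = Some (\<lambda>n. w n vs)" if "map sort_of vs = ss" for vs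
    using that by (intro seq_at_total) (auto simp: restr_def inj_def)
  have "restr ss (ml_op VM ?\<phi>) = restr ss (\<lambda>vs. Some (VM (mod_lim (\<lambda>n. w n vs))))"
    using seq by (auto simp: restr_def restrict_map_def ml_op_def fun_eq_iff)
  then show ?thesis
    using ml_M[OF assms[unfolded total_computable_def]] by (simp add: total_computable_def)
qed

lemma total_computable_accum:
  assumes "total_computable \<iota> M a (SN # ss) SR (\<lambda>vs. VR (f (the_nat (hd vs)) (tl vs)))"
    and "total_computable \<iota> M a (SN # ss) SM (\<lambda>vs. VM (u (the_nat (hd vs)) (tl vs)))"
    and nonneg: "\<And>n vs. f n vs \<ge> 0"
    and defined: "\<And>vs. map sort_of vs = ss \<Longrightarrow> accum (\<lambda>n. f n vs) (\<lambda>n. u n vs) = Some (s vs)"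
  shows "total_computable \<iota> M a ss SM (\<lambda>vs. VM (s vs))"
proof -
  let ?\<psi> = "restr (SN # ss) (\<lambda>vs. Some (VR (f (the_nat (hd vs)) (tl vs))))"
  let ?\<phi> = "restr (SN # ss) (\<lambda>vs. Some (VM (u (the_nat (hd vs)) (tl vs))))"
  have "seq_at VR ?\<psi> vs = Some (\<lambda>n. f n vs)" "seq_at VM ?\<phi> vs = Some (\<lambda>n. u n vs)"
    if "map sort_of vs = ss" for vs
    using that by (intro seq_at_total; auto simp: restr_def inj_def)+
  then have "restr ss (accum_op VM ?\<psi> ?\<phi>) = restr ss (\<lambda>vs. Some (VM (s vs)))"
    using nonneg defined by (auto simp: restr_def restrict_map_def accum_op_def fun_eq_iff)
  then show ?thesis
    using accum_M[OF assms(1,2)[unfolded total_computable_def]] by (simp add: total_computable_def)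
qed

lemma int_computable_funI:
  assumes "total_computable \<iota> M a [SX] SM (\<lambda>vs. VM (g (the_point (vs ! 0))))"
  shows "int_computable_fun \<iota> M a g"
proof -
  have "restr [SX] (\<lambda>vs. Some (VM (g (the_point (vs ! 0))))) vs =
    (case vs of [VX x] \<Rightarrow> Some (VM (g x)) | _ \<Rightarrow> None)" for vs
    by (auto simp: restr_def restrict_map_def sort_of_cases map_eq_Cons_conv split: list.split val.split)
  then show ?thesis
    using assms unfolding total_computable_def int_computable_fun_def by presburger
qed

section \<open>The approximate retractions\<close>

text \<open>
  The expression \<open>t + \<bar>t\<bar>\<close> is twice the positive part of \<open>t\<close>, and \<open>2^k + 2^k\<close>
  is \<open>2^(k+1)\<close>; both are written so that they are built from the basic functions.
\<close>

definition bump ::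
  "('m \<Rightarrow> 'x::metric_space) \<Rightarrow> 'x set \<Rightarrow> (nat \<Rightarrow> 'm) \<Rightarrow> nat \<Rightarrow> nat \<Rightarrow> 'x \<Rightarrow> real" where
  "bump \<iota> M a k n x =
    (let t = 1 + (2 ^ k + 2 ^ k) * (infdist x M - dist x (\<iota> (a n))) in t + \<bar>t\<bar>)"

text \<open>
  For a dense sequence the accumulation is always defined, so \<open>the\<close> extracts an actual value.
\<close>

definition approx_retraction ::
  "('m::real_normed_vector \<Rightarrow> 'x::metric_space) \<Rightarrow> 'x set \<Rightarrow> (nat \<Rightarrow> 'm) \<Rightarrow> nat \<Rightarrow> 'x \<Rightarrow> 'm" where
  "approx_retraction \<iota> M a k x = the (accum (\<lambda>n. bump \<iota> M a k n x) a)"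

lemma bump_nonneg: "bump \<iota> M a k n x \<ge> 0"
  by (simp add: bump_def Let_def)

lemma continuous_on_bump: "continuous_on S (bump \<iota> M a k n)"
  unfolding bump_def Let_def by (intro continuous_intros)

lemma bump_pos_imp_near:
  assumes "bump \<iota> M a k n x > 0"
  shows "dist x (\<iota> (a n)) < infdist x M + (1/2) ^ Suc k"
proof -
  have "0 < 1 + 2 ^ Suc k * (infdist x M - dist x (\<iota> (a n)))"
    using assms by (auto simp: bump_def Let_def abs_if split: if_splits)
  then have "0 < (1/2) ^ Suc k * (1 + 2 ^ Suc k * (infdist x M - dist x (\<iota> (a n))))"
    by (intro mult_pos_pos) auto
  also have "\<dots> = (1/2) ^ Suc k + (infdist x M - dist x (\<iota> (a n)))"
    by (simp add: distrib_left power_divide)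
  finally show ?thesis by simp
qed

text \<open>
  Halving the slack leaves \<open>t > 1/2\<close>, and the weight is \<open>2 t\<close>. Hence a single point
  suffices to push the sum of the weights above 1.
\<close>

lemma near_imp_bump_gt_1:
  assumes "dist x (\<iota> (a n)) < infdist x M + (1/2) ^ Suc (Suc k)"
  shows "bump \<iota> M a k n x > 1"
proof -
  have "2 ^ Suc k * (dist x (\<iota> (a n)) - infdist x M) < 2 ^ Suc k * (1/2) ^ Suc (Suc k)"
    using assms by (intro mult_strict_left_mono) auto
  also have "\<dots> = 1/2"
    by (simp add: power_divide)
  finally show ?thesis
    by (simp add: bump_def Let_def algebra_simps)
qed

lemma sum_bump_gt_1:
  fixes \<iota> :: "'m::metric_space \<Rightarrow> 'x::metric_space"
  assumes "range \<iota> = M" "\<And>u v. dist (\<iota> u) (\<iota> v) = dist u v" "closure (range a) = UNIV"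
  shows "\<exists>N. (\<Sum>n<N. bump \<iota> M a k n x) > 1"
proof -
  obtain n where "dist x (\<iota> (a n)) < infdist x M + (1/2) ^ Suc (Suc k)"
    using dense_approx_infdist[OF assms, of "(1/2) ^ Suc (Suc k)" x] by auto
  then have "1 < bump \<iota> M a k n x"
    by (rule near_imp_bump_gt_1)
  also have "\<dots> \<le> (\<Sum>i<Suc n. bump \<iota> M a k i x)"
    by (intro member_le_sum) (auto simp: bump_nonneg)
  finally show ?thesis ..
qed

text \<open>
  The index over which the accumulation runs comes first, followed by \<open>k\<close> and \<open>x\<close>.
\<close>

lemma total_computable_bump:
  "total_computable \<iota> M a [SN, SN, SX] SR
    (\<lambda>vs. VR (bump \<iota> M a (the_nat (vs ! 1)) (the_nat (vs ! 0)) (the_point (vs ! 2))))"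
  unfolding bump_def Let_def
  by (intro total_computable_add total_computable_abs total_computable_mult total_computable_diff
      total_computable_one total_computable_power2 total_computable_infdist total_computable_dist
      total_computable_incl total_computable_enum total_computable_nat_arg
      total_computable_point_arg) auto

lemma total_computable_approx_retraction:
  assumes "range \<iota> = M" "\<And>u v. dist (\<iota> u) (\<iota> v) = dist u v" "closure (range a) = UNIV"
  shows "total_computable \<iota> M a [SN, SX] SM
    (\<lambda>vs. VM (approx_retraction \<iota> M a (the_nat (vs ! 0)) (the_point (vs ! 1))))"
proof (rule total_computable_accum)
  let ?f = "\<lambda>n vs. bump \<iota> M a (the_nat (vs ! 0)) n (the_point (vs ! 1))"
  show "total_computable \<iota> M a [SN, SN, SX] SR (\<lambda>vs. VR (?f (the_nat (hd vs)) (tl vs)))"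
    by (rule total_computable_cong[THEN iffD1, OF _ total_computable_bump])
      (auto simp: map_eq_Cons_conv)
  have "total_computable \<iota> M a [SN, SN, SX] SM (\<lambda>vs. VM (a (the_nat (vs ! 0))))"
    by (intro total_computable_enum total_computable_nat_arg) auto
  then show "total_computable \<iota> M a [SN, SN, SX] SM (\<lambda>vs. VM (a (the_nat (hd vs))))"
    by (rule total_computable_cong[THEN iffD1, rotated]) (auto simp: map_eq_Cons_conv)
  show "accum (\<lambda>n. ?f n vs) a =
      Some (approx_retraction \<iota> M a (the_nat (vs ! 0)) (the_point (vs ! 1)))" for vs
    using sum_bump_gt_1[OF assms, of "the_nat (vs ! 0)" "the_point (vs ! 1)"]
    by (auto simp: approx_retraction_def accum_eq_weighted_sum bump_nonneg)
qed (rule bump_nonneg)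

lemma continuous_on_approx_retraction:
  assumes "range \<iota> = M" "\<And>u v. dist (\<iota> u) (\<iota> v) = dist u v" "closure (range a) = UNIV"
  shows "continuous_on UNIV (approx_retraction \<iota> M a k)"
  unfolding approx_retraction_def
  by (intro continuous_on_accum bump_nonneg continuous_on_bump sum_bump_gt_1 assms)

lemma approx_retraction_near:
  assumes "range \<iota> = M" "\<And>u v. dist (\<iota> u) (\<iota> v) = dist u v" "closure (range a) = UNIV"
  shows "norm (approx_retraction \<iota> M a k (\<iota> u) - u) \<le> (1/2) ^ Suc k"
proof -
  obtain N where N: "(\<Sum>n<N. bump \<iota> M a k n (\<iota> u)) > 1"
    using sum_bump_gt_1[OF assms] by blast
  show ?thesis
    unfolding approx_retraction_def
  proof (rule norm_accum_diff_le[OF bump_nonneg N])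
    fix n assume "bump \<iota> M a k n (\<iota> u) > 0"
    moreover have "infdist (\<iota> u) M = 0"
      using assms(1) by auto
    ultimately have "dist (\<iota> u) (\<iota> (a n)) < (1/2) ^ Suc k"
      using bump_pos_imp_near by fastforce
    then show "norm (a n - u) \<le> (1/2) ^ Suc k"
      unfolding assms(2) by (simp add: dist_norm norm_minus_commute)
  qed
qed

section \<open>The retraction\<close>

theorem theorem3p8:
  fixes M :: "'x::metric_space set" and \<iota> :: "'m::banach \<Rightarrow> 'x"
  assumes "separable_space (euclidean :: 'x topology)"
    and "closed M"
    and "bij_betw \<iota> UNIV M"
    and "\<And>u v. norm (u - v) = dist (\<iota> u) (\<iota> v)"
  shows "(\<exists>a :: nat \<Rightarrow> 'm. closure (range a) = UNIV) \<and>
    (\<forall>a :: nat \<Rightarrow> 'm. closure (range a) = UNIV \<longrightarrow>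
      (\<exists>g :: 'x \<Rightarrow> 'm. continuous_on UNIV g \<and> (\<forall>u. g (\<iota> u) = u) \<and>
        int_computable_fun \<iota> M a g))"
proof (intro conjI allI impI)
  have iso: "dist (\<iota> u) (\<iota> v) = dist u v" for u v
    using assms(4) by (simp add: dist_norm)
  have range: "range \<iota> = M"
    using assms(3) by (simp add: bij_betw_def)
  show "\<exists>a :: nat \<Rightarrow> 'm. closure (range a) = UNIV"
    by (rule separable_dense_sequence[OF assms(1) iso])
  fix a :: "nat \<Rightarrow> 'm" assume dense: "closure (range a) = UNIV"
  let ?w = "approx_retraction \<iota> M a"
  define g where "g x = mod_lim (\<lambda>k. ?w k x)" for x
  have "continuous_on UNIV g"
    unfolding g_def
    by (intro continuous_on_mod_lim continuous_on_approx_retraction range iso dense)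
  moreover have "g (\<iota> u) = u" for u
    unfolding g_def by (intro mod_lim_eq approx_retraction_near range iso dense)
  moreover have "int_computable_fun \<iota> M a g"
    unfolding g_def
  proof (intro int_computable_funI total_computable_mod_lim)
    show "total_computable \<iota> M a [SN, SX] SM
        (\<lambda>vs. VM (?w (the_nat (hd vs)) (the_point (tl vs ! 0))))"
      by (rule total_computable_cong[THEN iffD1,
            OF _ total_computable_approx_retraction[OF range iso dense]])
        (auto simp: map_eq_Cons_conv)
  qed
  ultimately show "\<exists>g. continuous_on UNIV g \<and> (\<forall>u. g (\<iota> u) = u) \<and> int_computable_fun \<iota> M a g"
    by blast
qed

end
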